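(* Let $s\subseteq N$ and $g\in G$, and suppose $M_s\ge\max\{V(s),0\}$ and $V(\{i\})\ge0$ for all $i\in s$. (Both hold in the present model with $M_s=V(s)$, since the empty solution is feasible and profits are nonnegative.) Consider the stability inequality for the pair $(g,s)$: $$\sum_{i\in s}v_i\ \ge\ V(s)-M_s\Bigl(|s|-\sum_{i\in s}z_{ig}\Bigr).\qquad(\ast)$$ (i) (Validity) Every mixed-integer point of $\mathcal F$ that encodes an SCS satisfies $(\ast)$ for the pair $(g,s)$. (ii) (Exact separation) A mixed-integer point of $\mathcal F$ with $s\subseteq c(g)$ and $\sum_{i\in s}v_i<V(s)$ violates $(\ast)$.
   Context: **Game.** $N=\{1,\dots,n\}$ is a finite player set, $R$ a finite item set, $I_j\subseteq N$ the set of players for whom item $j$ is available, $R_i=\{j\in R:i\in I_j\}$. Data: profits $p^i_j\ge0$, weights $a_j>0$, budgets $b^i$, capacities $u^i_j\ge 0$, private constraints $B^ix^i\le d^i$, and a pooling parameter $\alpha\in(0,1]$. For a coalition $c\subseteq N$ let $I^c_j=I_j\cap c$, $R^c=\{j:I^c_j\ne\emptyset\}$, $R^c_{\mathrm{ind}}=\{j\in R^c:|I^c_j|=1\}$, $R^c_{\mathrm{com}}=\{j\in R^c:|I^c_j|\ge2\}$. With variables $x^i=(x^i_j)_{j\in R_i}$ for $i\in c$ and $y^c_j$ for $j\in R^c_{\mathrm{com}}$, $V(c)$ is the maximum of $\sum_{j\in R^c}\sum_{i\in I^c_j}p^i_jx^i_j$ subject to: $\sum_{j\in R^c_{\mathrm{com}}}a_jy^c_j+\sum_{j\in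 R^c_{\mathrm{ind}}}\sum_{i\in I^c_j}a_jx^i_j\le\sum_{i\in c}b^i$; $y^c_j=\sum_{i\in I^c_j}x^i_j$ for $j\in R^c_{\mathrm{com}}$; $B^ix^i\le d^i$ for $i\in c$; $0\le x^i_j\le u^i_j$; $0\le y^c_j\le\alpha\sum_{i\in I^c_j}u^i_j$ and $y^c_j\in\mathbb Z_+$ for $j\in R^c_{\mathrm{com}}$; $x^i_j\in\mathbb Z_+$ for $j\in R^c_{\mathrm{ind}}$ (the $x^i_j$ with $j\in R^c_{\mathrm{com}}$ are continuous). $V(\emptyset)=0$. Standing assumptions: every such program is feasible and bounded, the zero plan is feasible for every program, and the private constraints do not tie a member's common items to its other decisions. **Stability.** The Core of the game restricted to $c$ is the set of $(w_i)_{i\in c}$ with $\sum_{i\in c}w_i=V(c)$ and $\sum_{i\in s}w_i\ge V(s)$ for all $s\subseteq c$. A partition $CS(N)$ of $N$ with payoff vector $v\in\mathbb R^N$ is a stable coalition structure (SCS) if for every $c\in CS(N)$ the restriction of $v$ to $c$ lies in the Core of the game restricted to $c$. **The set $\mathcal F$.** Let $G:=N$ index groups. $\mathcal F$ is the set of mixed-integer points with variables $v_i$, $z_{ig}$, $x^{i,g}_j$ ($j\in R$, $i\in I_j$), $y^g_j$, $\pi_g$, and auxiliary $\phi_{ig}$ (and $w^g_j$ if $\alpha<1$) satisfying, for all $i\in N$, $g\in G$, $j\in R$: (1) $\sum_{g\in G}z_{ig}=1$; (2) $\pi_g=\sum_{j\in R}\sum_{i\in I_j}p^i_jx^{i,g}_j=\sum_{i\in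 N}\phi_{ig}$; (3) $\phi_{ig}\le v_i$, $\phi_{ig}\le Mz_{ig}$, $\phi_{ig}\ge v_i-M(1-z_{ig})$, $\phi_{ig}\ge0$, where $M=\sum_{i\in N}\sum_{j\in R_i}p^i_ju^i_j$; (4) $\sum_{j\in R}a_jy^g_j\le\sum_{i\in N}b^iz_{ig}$; (5) $y^g_j=\sum_{i\in I_j}x^{i,g}_j$; (6) $B^ix^{i,g}\le d^iz_{ig}$; (7) $0\le x^{i,g}_j\le u^i_jz_{ig}$ for $i\in I_j$; (8) $y^g_j\le\sum_{i\in I_j}u^i_jz_{ig}$; (9) $z_{ig}=0$ whenever $i<g$; (10) $\sum_{i\in N}z_{ig}\le|N|z_{gg}$; (11) $v_i\ge0$, $\pi_g\ge 0$, $y^g_j\in\mathbb Z_+$, $z_{ig}\in\{0,1\}$; (12) only if $\alpha<1$: $w^g_j\in\{0,1\}$, $2w^g_j\le\sum_{i\in I_j}z_{ig}\le(|I_j|-1)w^g_j+1$, and $y^g_j\le\alpha\sum_{i\in I_j}u^i_jz_{ig}+M_j(1-w^g_j)$, where $M_j\ge(1-\alpha)\max_{i\in I_j}u^i_j$. For a mixed-integer point write $c(g)=\{i\in N:z_{ig}=1\}$; the nonempty sets $c(g)$ form a partition of $N$. The point encodes an SCS if this partition together with $v$ is an SCS. *)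

theory Defs
  imports "HOL-Analysis.Analysis"
begin

record 'r pooling_data =
  num_players :: nat
  items :: "'r set"
  avail :: "'r \<Rightarrow> nat set"
  profit :: "nat \<Rightarrow> 'r \<Rightarrow> real"
  weight :: "'r \<Rightarrow> real"
  budget :: "nat \<Rightarrow> real"
  capacity :: "nat \<Rightarrow> 'r \<Rightarrow> real"
  num_rows :: "nat \<Rightarrow> nat"
  priv_mat :: "nat \<Rightarrow> nat \<Rightarrow> 'r \<Rightarrow> real"
  priv_rhs :: "nat \<Rightarrow> nat \<Rightarrow> real"
  pool_frac :: real

definition players :: "'r pooling_data \<Rightarrow> nat set" where
  "players G = {1..num_players G}"

definition items_of :: "'r pooling_data \<Rightarrow> nat \<Rightarrow> 'r set" where
  "items_of G i = {j \<in> items G. i \<in> avail G j}"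

definition avail_in :: "'r pooling_data \<Rightarrow> nat set \<Rightarrow> 'r \<Rightarrow> nat set" where
  "avail_in G c j = avail G j \<inter> c"

definition coal_items :: "'r pooling_data \<Rightarrow> nat set \<Rightarrow> 'r set" where
  "coal_items G c = {j \<in> items G. avail_in G c j \<noteq> {}}"

definition ind_items :: "'r pooling_data \<Rightarrow> nat set \<Rightarrow> 'r set" where
  "ind_items G c = {j \<in> coal_items G c. card (avail_in G c j) = 1}"

definition com_items :: "'r pooling_data \<Rightarrow> nat set \<Rightarrow> 'r set" where
  "com_items G c = {j \<in> coal_items G c. card (avail_in G c j) \<ge> 2}"

text \<open>Row \<open>k\<close> of the product \<open>B\<^sup>i r\<close>; the system \<open>B\<^sup>i r \<le> d\<^sup>i\<close> has the rows
  \<open>k < num_rows G i\<close>.\<close>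

definition priv_row :: "'r pooling_data \<Rightarrow> nat \<Rightarrow> nat \<Rightarrow> ('r \<Rightarrow> real) \<Rightarrow> real" where
  "priv_row G i k r = (\<Sum>j\<in>items_of G i. priv_mat G i k j * r j)"

definition priv_feasible :: "'r pooling_data \<Rightarrow> nat \<Rightarrow> ('r \<Rightarrow> real) \<Rightarrow> bool" where
  "priv_feasible G i r \<longleftrightarrow> (\<forall>k<num_rows G i. priv_row G i k r \<le> priv_rhs G i k)"

definition feasible_plan ::
  "'r pooling_data \<Rightarrow> nat set \<Rightarrow> (nat \<Rightarrow> 'r \<Rightarrow> real) \<Rightarrow> ('r \<Rightarrow> real) \<Rightarrow> bool" where
  "feasible_plan G c x y \<longleftrightarrow>
     (\<Sum>j\<in>com_items G c. weight G j * y j)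
       + (\<Sum>j\<in>ind_items G c. \<Sum>i\<in>avail_in G c j. weight G j * x i j) \<le> (\<Sum>i\<in>c. budget G i) \<and>
     (\<forall>j\<in>com_items G c. y j = (\<Sum>i\<in>avail_in G c j. x i j)) \<and>
     (\<forall>i\<in>c. priv_feasible G i (x i)) \<and>
     (\<forall>i\<in>c. \<forall>j\<in>items_of G i. 0 \<le> x i j \<and> x i j \<le> capacity G i j) \<and>
     (\<forall>j\<in>com_items G c.
        0 \<le> y j \<and> y j \<le> pool_frac G * (\<Sum>i\<in>avail_in G c j. capacity G i j) \<and> y j \<in> \<nat>) \<and>
     (\<forall>j\<in>ind_items G c. \<forall>i\<in>avail_in G c j. x i j \<in> \<nat>)"

definition plan_profit :: "'r pooling_data \<Rightarrow> nat set \<Rightarrow> (nat \<Rightarrow> 'r \<Rightarrow> real) \<Rightarrow> real" where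
  "plan_profit G c x = (\<Sum>j\<in>coal_items G c. \<Sum>i\<in>avail_in G c j. profit G i j * x i j)"

definition plan_values :: "'r pooling_data \<Rightarrow> nat set \<Rightarrow> real set" where
  "plan_values G c = {plan_profit G c x | x y. feasible_plan G c x y}"

definition coal_value :: "'r pooling_data \<Rightarrow> nat set \<Rightarrow> real" where
  "coal_value G c = (if c = {} then 0 else (GREATEST t. t \<in> plan_values G c))"

text \<open>The assumption \<open>untied\<close> says that, for a member \<open>i\<close> of a coalition \<open>c\<close>, the private
  feasible region is the product of its projections onto the items that are common in \<open>c\<close> and
  onto the remaining items of \<open>i\<close>.\<close>

locale pooling_game =
  fixes G :: "'r pooling_data"
  assumes finite_items: "finite (items G)"
    and avail_players: "j \<in> items G \<Longrightarrow> avail G j \<subseteq> players G"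
    and profit_nonneg: "j \<in> items G \<Longrightarrow> i \<in> avail G j \<Longrightarrow> 0 \<le> profit G i j"
    and weight_pos: "j \<in> items G \<Longrightarrow> 0 < weight G j"
    and capacity_nonneg: "j \<in> items G \<Longrightarrow> i \<in> avail G j \<Longrightarrow> 0 \<le> capacity G i j"
    and pool_frac_range: "0 < pool_frac G" "pool_frac G \<le> 1"
    and feasible: "c \<subseteq> players G \<Longrightarrow> \<exists>x y. feasible_plan G c x y"
    and bounded: "c \<subseteq> players G \<Longrightarrow> bdd_above (plan_values G c)"
    and zero_feasible: "c \<subseteq> players G \<Longrightarrow> feasible_plan G c (\<lambda>_ _. 0) (\<lambda>_. 0)"
    and untied: "c \<subseteq> players G \<Longrightarrow> i \<in> c \<Longrightarrow> priv_feasible G i r \<Longrightarrow> priv_feasible G i r' \<Longrightarrow>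
           priv_feasible G i (\<lambda>j. if j \<in> com_items G c then r j else r' j)"

definition core :: "'r pooling_data \<Rightarrow> nat set \<Rightarrow> (nat \<Rightarrow> real) set" where
  "core G c = {w \<in> c \<rightarrow>\<^sub>E UNIV. (\<Sum>i\<in>c. w i) = coal_value G c \<and>
                 (\<forall>s\<subseteq>c. (\<Sum>i\<in>s. w i) \<ge> coal_value G s)}"

definition stable_structure :: "'r pooling_data \<Rightarrow> nat set set \<Rightarrow> (nat \<Rightarrow> real) \<Rightarrow> bool" where
  "stable_structure G CS v \<longleftrightarrow>
     partition_on (players G) CS \<and> (\<forall>c\<in>CS. restrict v c \<in> core G c)"

text \<open>Index order: \<open>pt_z i g\<close>, \<open>pt_phi i g\<close>, \<open>pt_x i g j\<close>, \<open>pt_y g j\<close>, \<open>pt_w g j\<close>.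
  If \<open>pool_frac G = 1\<close>, then \<open>pt_w\<close> is unconstrained.\<close>

record 'r mip_point =
  pt_v :: "nat \<Rightarrow> real"
  pt_z :: "nat \<Rightarrow> nat \<Rightarrow> real"
  pt_x :: "nat \<Rightarrow> nat \<Rightarrow> 'r \<Rightarrow> real"
  pt_y :: "nat \<Rightarrow> 'r \<Rightarrow> real"
  pt_pi :: "nat \<Rightarrow> real"
  pt_phi :: "nat \<Rightarrow> nat \<Rightarrow> real"
  pt_w :: "nat \<Rightarrow> 'r \<Rightarrow> real"

definition big_M :: "'r pooling_data \<Rightarrow> real" where
  "big_M G = (\<Sum>i\<in>players G. \<Sum>j\<in>items_of G i. profit G i j * capacity G i j)"

text \<open>The constants \<open>M\<^sub>j\<close> occur only if the pooling parameter is below \<open>1\<close>; the maximum is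
  undefined, and hence imposes nothing, if \<open>j\<close> is available to nobody.\<close>

definition valid_item_Ms :: "'r pooling_data \<Rightarrow> ('r \<Rightarrow> real) \<Rightarrow> bool" where
  "valid_item_Ms G Mj \<longleftrightarrow> (pool_frac G < 1 \<longrightarrow>
     (\<forall>j\<in>items G. avail G j \<noteq> {} \<longrightarrow>
        Mj j \<ge> (1 - pool_frac G) * Max ((\<lambda>i. capacity G i j) ` avail G j)))"

definition mip_set :: "'r pooling_data \<Rightarrow> ('r \<Rightarrow> real) \<Rightarrow> 'r mip_point set" where
  "mip_set G Mj = {P.
     (\<forall>i\<in>players G. (\<Sum>g\<in>players G. pt_z P i g) = 1) \<and>
     (\<forall>g\<in>players G.
        pt_pi P g = (\<Sum>j\<in>items G. \<Sum>i\<in>avail G j. profit G i j * pt_x P i g j) \<and>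
        pt_pi P g = (\<Sum>i\<in>players G. pt_phi P i g)) \<and>
     (\<forall>i\<in>players G. \<forall>g\<in>players G.
        pt_phi P i g \<le> pt_v P i \<and>
        pt_phi P i g \<le> big_M G * pt_z P i g \<and>
        pt_phi P i g \<ge> pt_v P i - big_M G * (1 - pt_z P i g) \<and>
        pt_phi P i g \<ge> 0) \<and>
     (\<forall>g\<in>players G.
        (\<Sum>j\<in>items G. weight G j * pt_y P g j) \<le> (\<Sum>i\<in>players G. budget G i * pt_z P i g)) \<and>
     (\<forall>g\<in>players G. \<forall>j\<in>items G. pt_y P g j = (\<Sum>i\<in>avail G j. pt_x P i g j)) \<and>
     (\<forall>i\<in>players G. \<forall>g\<in>players G. \<forall>k<num_rows G i.
        priv_row G i k (pt_x P i g) \<le> priv_rhs G i k * pt_z P i g) \<and>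
     (\<forall>g\<in>players G. \<forall>j\<in>items G. \<forall>i\<in>avail G j.
        0 \<le> pt_x P i g j \<and> pt_x P i g j \<le> capacity G i j * pt_z P i g) \<and>
     (\<forall>g\<in>players G. \<forall>j\<in>items G.
        pt_y P g j \<le> (\<Sum>i\<in>avail G j. capacity G i j * pt_z P i g)) \<and>
     (\<forall>i\<in>players G. \<forall>g\<in>players G. i < g \<longrightarrow> pt_z P i g = 0) \<and>
     (\<forall>g\<in>players G. (\<Sum>i\<in>players G. pt_z P i g) \<le> real (card (players G)) * pt_z P g g) \<and>
     (\<forall>i\<in>players G. pt_v P i \<ge> 0) \<and>
     (\<forall>g\<in>players G. pt_pi P g \<ge> 0) \<and>
     (\<forall>g\<in>players G. \<forall>j\<in>items G. pt_y P g j \<in> \<nat>) \<and>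
     (\<forall>i\<in>players G. \<forall>g\<in>players G. pt_z P i g \<in> {0, 1}) \<and>
     (pool_frac G < 1 \<longrightarrow> (\<forall>g\<in>players G. \<forall>j\<in>items G.
        pt_w P g j \<in> {0, 1} \<and>
        2 * pt_w P g j \<le> (\<Sum>i\<in>avail G j. pt_z P i g) \<and>
        (\<Sum>i\<in>avail G j. pt_z P i g) \<le> (real (card (avail G j)) - 1) * pt_w P g j + 1 \<and>
        pt_y P g j \<le> pool_frac G * (\<Sum>i\<in>avail G j. capacity G i j * pt_z P i g)
                       + Mj j * (1 - pt_w P g j)))}"

definition group_members :: "'r pooling_data \<Rightarrow> 'r mip_point \<Rightarrow> nat \<Rightarrow> nat set" where
  "group_members G P g = {i \<in> players G. pt_z P i g = 1}"

definition encodes_stable :: "'r pooling_data \<Rightarrow> 'r mip_point \<Rightarrow> bool" where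
  "encodes_stable G P \<longleftrightarrow>
     stable_structure G {group_members G P g | g. g \<in> players G \<and> group_members G P g \<noteq> {}} (pt_v P)"

definition stability_ineq ::
  "'r pooling_data \<Rightarrow> 'r mip_point \<Rightarrow> nat \<Rightarrow> nat set \<Rightarrow> real \<Rightarrow> bool" where
  "stability_ineq G P g s Ms \<longleftrightarrow>
     (\<Sum>i\<in>s. pt_v P i) \<ge> coal_value G s - Ms * (real (card s) - (\<Sum>i\<in>s. pt_z P i g))"

end

theory Submission
  imports Defs
begin

text \<open>The programs defining the coalition values have closed constraints in boundedly many bounded
  variables, so their maxima are attained; since the zero plan is feasible, the values are
  nonnegative. For a coalition inside group \<open>g\<close> the big-M term vanishes and the stability inequality
  is the core inequality; otherwise that term is at least \<open>Ms\<close> and the right-hand side is at most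
  \<open>0\<close>.\<close>

lemma continuous_on_eval2 [continuous_intros]:
  "continuous_on A (\<lambda>x :: 'a \<Rightarrow> 'b \<Rightarrow> 'c :: topological_space. x i j)"
  by (rule continuous_on_product_then_coordinatewise
      [OF continuous_on_product_then_coordinatewise[OF continuous_on_id]])

text \<open>Tychonoff's theorem, applied once per argument: function types carry the product
  topology, so the index types may be infinite.\<close>

lemma compact_box2:
  fixes K :: "'a \<Rightarrow> 'b \<Rightarrow> 'c :: topological_space set"
  assumes "\<And>i j. compact (K i j)"
  shows "compact {x. \<forall>i j. x i j \<in> K i j}"
proof -
  \<comment> \<open>Stated with fresh type variables in order to serve both for the inner boxes
    \<open>PiE UNIV (K i)\<close> and for the outer one.\<close>
  have box: "compact (PiE UNIV L)" if "\<And>a. compact (L a)"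
    for L :: "'d \<Rightarrow> 'e :: topological_space set"
    using that compactin_PiE[of "\<lambda>_. euclidean" UNIV L]
    by (simp add: euclidean_product_topology)
  have "{x. \<forall>i j. x i j \<in> K i j} = PiE UNIV (\<lambda>i. PiE UNIV (K i))"
    by (auto simp: PiE_iff)
  then show ?thesis
    by (simp add: box assms)
qed

lemma priv_feasible_cong:
  assumes "\<And>j. j \<in> items_of G i \<Longrightarrow> r j = r' j"
  shows "priv_feasible G i r \<longleftrightarrow> priv_feasible G i r'"
  using assms by (simp add: priv_feasible_def priv_row_def)

lemma feasible_plan_cong:
  assumes x: "\<And>i j. i \<in> c \<Longrightarrow> j \<in> items_of G i \<Longrightarrow> x i j = x' i j"
    and y: "\<And>j. j \<in> com_items G c \<Longrightarrow> y j = y' j"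
  shows "feasible_plan G c x y \<longleftrightarrow> feasible_plan G c x' y'"
proof -
  have item: "x i j = x' i j" if "j \<in> coal_items G c" "i \<in> avail_in G c j" for i j
    using that x by (auto simp: coal_items_def avail_in_def items_of_def)
  have com: "\<And>j. j \<in> com_items G c \<Longrightarrow> j \<in> coal_items G c"
    and ind: "\<And>j. j \<in> ind_items G c \<Longrightarrow> j \<in> coal_items G c"
    by (auto simp: com_items_def ind_items_def)
  have priv: "priv_feasible G i (x i) \<longleftrightarrow> priv_feasible G i (x' i)" if "i \<in> c" for i
    by (intro priv_feasible_cong x that)
  show ?thesis
    unfolding feasible_plan_def
    by (simp add: x y item com ind priv cong: sum.cong ball_cong)
qed

lemma plan_profit_cong:
  assumes "\<And>i j. i \<in> c \<Longrightarrow> j \<in> items_of G i \<Longrightarrow> x i j = x' i j"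
  shows "plan_profit G c x = plan_profit G c x'"
  unfolding plan_profit_def
  using assms
  by (intro sum.cong refl) (auto simp: coal_items_def avail_in_def items_of_def)

abbreviation pooled :: "'r pooling_data \<Rightarrow> nat set \<Rightarrow> (nat \<Rightarrow> 'r \<Rightarrow> real) \<Rightarrow> 'r \<Rightarrow> real" where
  "pooled G c x \<equiv> \<lambda>j. \<Sum>i\<in>avail_in G c j. x i j"

text \<open>The coupling equations determine \<open>y\<close> on the common items. Eliminating it
  turns feasibility into a condition on \<open>x\<close> alone.\<close>

lemma feasible_plan_pooled:
  assumes "feasible_plan G c x y"
  shows "feasible_plan G c x (pooled G c x)"
proof -
  have "y j = pooled G c x j" if "j \<in> com_items G c" for j
    using assms that by (auto simp: feasible_plan_def)
  then show ?thesis
    using assms feasible_plan_cong[of c G x x y "pooled G c x"] by simp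
qed

text \<open>Integrality is a closed condition because the naturals are closed in the reals; the
  other constraints are weak inequalities and equations between continuous functions of
  \<open>x\<close>.\<close>

lemma closed_feasible_plans: "closed {x. feasible_plan G c x (pooled G c x)}"
proof -
  have nat: "closed {x. f x \<in> \<nat>}" if "continuous_on UNIV f"
    for f :: "(nat \<Rightarrow> 'a \<Rightarrow> real) \<Rightarrow> real"
    using closed_vimage[OF closed_Nats that] by (simp add: vimage_def)
  show ?thesis
    \<comment> \<open>Bounded quantifiers become implications whose premises do not mention
      \<open>x\<close>; such premises define open sets, as closedness of an implication
      requires.\<close>
    unfolding feasible_plan_def Ball_def priv_feasible_def priv_row_def
    by (intro closed_Collect_conj closed_Collect_all closed_Collect_imp closed_Collect_le
        closed_Collect_eq open_Collect_const nat continuous_intros)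
qed

text \<open>Entries of a plan outside the coalition are unconstrained; setting them to \<open>0\<close> makes the
  set of plans compact without changing the profits.\<close>

lemma compact_plan_values: "compact (plan_values G c)"
proof -
  define K where "K i j = (if i \<in> c \<and> j \<in> items_of G i then {0..capacity G i j} else {0})" for i j
  define S where "S = {x. \<forall>i j. x i j \<in> K i j} \<inter> {x. feasible_plan G c x (pooled G c x)}"
  have "compact S"
    unfolding S_def
    by (intro compact_Int_closed compact_box2 closed_feasible_plans) (simp add: K_def)
  moreover have "continuous_on S (plan_profit G c)"
    unfolding plan_profit_def by (intro continuous_intros)
  moreover have "plan_values G c = plan_profit G c ` S"
  proof (intro equalityI subsetI)
    fix t assume "t \<in> plan_values G c"
    then obtain x y where t: "t = plan_profit G c x" and xy: "feasible_plan G c x y"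
      by (auto simp: plan_values_def)
    define x' where "x' i j = (if i \<in> c \<and> j \<in> items_of G i then x i j else 0)" for i j
    have "feasible_plan G c x' y"
      using xy feasible_plan_cong[of c G x' x y y] by (simp add: x'_def)
    then have "feasible_plan G c x' (pooled G c x')"
      by (rule feasible_plan_pooled)
    moreover have "x' i j \<in> K i j" for i j
      using xy by (auto simp: x'_def K_def feasible_plan_def)
    moreover have "t = plan_profit G c x'"
      unfolding t by (rule plan_profit_cong) (simp add: x'_def)
    ultimately show "t \<in> plan_profit G c ` S"
      by (auto simp: S_def)
  qed (auto simp: S_def plan_values_def)
  ultimately show ?thesis
    by (simp add: compact_continuous_image)
qed

text \<open>\<open>GREATEST\<close> is informative only if a maximum exists; compactness supplies
  one, and \<open>t\<close> witnesses that the set is nonempty.\<close>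

lemma plan_value_le_coal_value:
  assumes "c \<noteq> {}" "t \<in> plan_values G c"
  shows "t \<le> coal_value G c"
proof -
  obtain m where "m \<in> plan_values G c" "\<forall>t\<in>plan_values G c. t \<le> m"
    using compact_attains_sup[OF compact_plan_values] assms(2) by blast
  then have "(GREATEST t. t \<in> plan_values G c) = m"
    by (intro Greatest_equality) auto
  then show ?thesis
    using \<open>\<forall>t\<in>plan_values G c. t \<le> m\<close> assms by (simp add: coal_value_def)
qed

lemma (in pooling_game) coal_value_nonneg:
  assumes "c \<subseteq> players G"
  shows "0 \<le> coal_value G c"
proof (cases "c = {}")
  case False
  have "plan_profit G c (\<lambda>_ _. 0) \<in> plan_values G c"
    unfolding plan_values_def using zero_feasible[OF assms] by blast
  then have "0 \<in> plan_values G c"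
    by (simp add: plan_profit_def)
  with False show ?thesis
    by (rule plan_value_le_coal_value)
qed (simp add: coal_value_def)

text \<open>All \<open>z\<close> entries of \<open>s\<close> are 1, so the factor of
  \<open>Ms\<close> is 0. This serves validity inside the group and exact separation alike.\<close>

lemma stability_ineq_inside_group:
  assumes "s \<subseteq> group_members G P g"
  shows "stability_ineq G P g s Ms \<longleftrightarrow> coal_value G s \<le> (\<Sum>i\<in>s. pt_v P i)"
proof -
  have "(\<Sum>i\<in>s. pt_z P i g) = (\<Sum>i\<in>s. 1)"
    using assms by (intro sum.cong) (auto simp: group_members_def)
  then show ?thesis
    by (simp add: stability_ineq_def)
qed

lemma encodes_stable_core_ineq:
  assumes "encodes_stable G P" "g \<in> players G" "s \<subseteq> group_members G P g"
  shows "coal_value G s \<le> (\<Sum>i\<in>s. pt_v P i)"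
\<comment> \<open>An empty group is not a block of the encoded structure and has no core condition.
  A nonempty \<open>s\<close> forces the group to be a block.\<close>
proof (cases "s = {}")
  case False
  define c where "c = group_members G P g"
  have "restrict (pt_v P) c \<in> core G c"
    using assms False unfolding encodes_stable_def stable_structure_def c_def by blast
  then have "coal_value G s \<le> (\<Sum>i\<in>s. restrict (pt_v P) c i)"
    using assms(3) by (simp add: core_def c_def)
  also have "\<dots> = (\<Sum>i\<in>s. pt_v P i)"
    using assms(3) by (intro sum.cong) (auto simp: c_def)
  finally show ?thesis .
qed (simp add: coal_value_def)

lemma stability_ineq_outside_group:
  assumes P: "P \<in> mip_set G Mj" and g: "g \<in> players G"
    and s: "s \<subseteq> players G" "\<not> s \<subseteq> group_members G P g"
    and Ms: "coal_value G s \<le> Ms" "0 \<le> Ms"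
  shows "stability_ineq G P g s Ms"
proof -
  have "\<forall>i\<in>players G. \<forall>g\<in>players G. pt_z P i g \<in> {0, 1}"
    using P unfolding mip_set_def by (elim CollectE conjE)
  moreover have "\<forall>i\<in>players G. pt_v P i \<ge> 0"
    using P unfolding mip_set_def by (elim CollectE conjE)
  ultimately have z: "pt_z P i g \<in> {0, 1}" and v: "0 \<le> pt_v P i" if "i \<in> s" for i
    using g s(1) that by blast+
  \<comment> \<open>A member of \<open>s\<close> outside the group: its binary \<open>z\<close>
    entry is not 1, hence 0.\<close>
  obtain k where k: "k \<in> s" "pt_z P k g = 0"
    using s z by (auto simp: group_members_def)
  have fin: "finite s"
    using s(1) by (rule finite_subset) (simp add: players_def)
  have "(\<Sum>i\<in>s. pt_z P i g) = (\<Sum>i\<in>s - {k}. pt_z P i g)"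
    using k fin by (simp add: sum.remove)
  also have "\<dots> \<le> real (card (s - {k})) * 1"
    using z by (intro sum_bounded_above) fastforce
  also have "\<dots> = real (card s) - 1"
    using fin k(1) card_gt_0_iff[of s] by (auto simp: of_nat_diff Suc_leI)
  \<comment> \<open>The missing member makes the factor of \<open>Ms\<close> at least 1; scaling by
    \<open>Ms\<close> keeps the order because \<open>0 \<le> Ms\<close>.\<close>
  finally have "Ms * 1 \<le> Ms * (real (card s) - (\<Sum>i\<in>s. pt_z P i g))"
    using Ms(2) by (intro mult_left_mono) auto
  moreover have "0 \<le> (\<Sum>i\<in>s. pt_v P i)"
    using v by (rule sum_nonneg)
  ultimately show ?thesis
    using Ms(1) by (simp add: stability_ineq_def)
qed

theorem proposition3:
  fixes G :: "'r pooling_data" and Mj :: "'r \<Rightarrow> real" and s :: "nat set" and g :: nat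
  assumes "pooling_game G"
    and "valid_item_Ms G Mj"
    and "s \<subseteq> players G"
    and "g \<in> players G"
  shows "(coal_value G s \<ge> max (coal_value G s) 0 \<and> (\<forall>i\<in>s. coal_value G {i} \<ge> 0)) \<and>
    (\<forall>Ms. Ms \<ge> max (coal_value G s) 0 \<and> (\<forall>i\<in>s. coal_value G {i} \<ge> 0) \<longrightarrow>
       (\<forall>P\<in>mip_set G Mj. encodes_stable G P \<longrightarrow> stability_ineq G P g s Ms) \<and>
       (\<forall>P\<in>mip_set G Mj. s \<subseteq> group_members G P g \<and> (\<Sum>i\<in>s. pt_v P i) < coal_value G s \<longrightarrow>
          \<not> stability_ineq G P g s Ms))"
proof (intro conjI allI impI ballI)
  interpret pooling_game G by fact
  \<comment> \<open>The choice \<open>Ms = coal_value G s\<close> is admissible because coalition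
    values are nonnegative.\<close>
  show "coal_value G s \<ge> max (coal_value G s) 0"
    using coal_value_nonneg[OF assms(3)] by simp
  show "coal_value G {i} \<ge> 0" if "i \<in> s" for i
    using that assms(3) by (intro coal_value_nonneg) auto
next
  fix Ms P
  assume "Ms \<ge> max (coal_value G s) 0 \<and> (\<forall>i\<in>s. coal_value G {i} \<ge> 0)"
    and P: "P \<in> mip_set G Mj" "encodes_stable G P"
  then have "coal_value G s \<le> Ms" "0 \<le> Ms"
    by auto
  then show "stability_ineq G P g s Ms"
    using stability_ineq_outside_group[OF P(1) assms(4,3)]
      encodes_stable_core_ineq[OF P(2) assms(4)]
    by (cases "s \<subseteq> group_members G P g") (auto simp: stability_ineq_inside_group)
next
  fix Ms P
  assume "s \<subseteq> group_members G P g \<and> (\<Sum>i\<in>s. pt_v P i) < coal_value G s"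
  then show "\<not> stability_ineq G P g s Ms"
    by (simp add: stability_ineq_inside_group)
qed

end
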